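(* Let $T$ be a finite set, $S=\{\eta:T\to\mathbb{N}\cup\{0\}\}$, let $A\subseteq S$ be a (nonempty) decreasing set and $\nu:T\to(0,+\infty)$. Let $\pi$, $\mathcal{L}$, $\mathcal{E}$, $\mathcal{F}$ be the associated probability measure, birth-and-death generator, Dirichlet form and function class defined in the context. Define $$\epsilon_0:=\sup_{\substack{x\in T,\ \eta\in A\\ \eta(x)>0}}\ \sum_{y\in T:\,y\ne x}\nu(y)\,\mathbf{1}(\eta-\delta_x+\delta_y\in A)\,\mathbf{1}(\eta+\delta_y\notin A),\qquad \epsilon_1:=\inf_{\substack{x\in T,\ \eta\in A\\ \eta(x)>0}}\ \nu(x)\,\mathbf{1}(\eta+\delta_x\notin A),$$ and assume $\epsilon_0\le 1$. Then, with $\kappa=1-\epsilon_0+\epsilon_1$, $$\kappa\,\mathcal{E}(f,\log f)\le \pi\left[\mathcal{L}^2f\,\log f\right]+\pi\left[\frac{(\mathcal{L}f)^2}{f}\right]\qquad\text{for every }f\in\mathcal{F}.$$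
   Context: Order: $\eta\le\xi$ iff $\eta(x)\le\xi(x)$ for all $x\in T$. $A\subseteq S$ is decreasing if $\xi\in A$, $\eta\in S$, $\eta\le\xi$ imply $\eta\in A$ ($A$ is the set of allowed configurations). For $x\in T$, $(\eta\pm\delta_x)(y):=\eta(y)\pm\mathbf{1}(x=y)$. Measure: $\pi(\eta)=\frac{\mathbf{1}(\eta\in A)}{Z}\prod_{x\in T}\frac{\nu(x)^{\eta(x)}}{\eta(x)!}$, with $Z$ the normalization; $\pi[f]=\int f\,d\pi$. Moves: $\gamma_x^{\pm}:A\to A$, with $\gamma_x^{\pm}(\eta)=\eta\pm\delta_x$ if $\eta\pm\delta_x\in A$ and $\gamma_x^\pm(\eta)=\eta$ otherwise (in particular $\gamma_x^-(\eta)=\eta$ if $\eta(x)=0$); $\nabla_x^\pm f(\eta)=f(\gamma_x^\pm(\eta))-f(\eta)$. Generator: on bounded functions, $\mathcal{L}f(\eta)=\sum_{x\in T}\left[\eta(x)\nabla_x^-f(\eta)+\nu(x)\nabla_x^+f(\eta)\right]$; it is symmetric and $-\mathcal{L}$ is nonnegative in $L^2(\pi)$ on bounded functions, and $\mathcal{L}$ also denotes its Friedrichs self-adjoint extension, with domain $\mathcal{D}(\mathcal{L})$. $\mathcal{E}(f,g):=-\pi[g\,\mathcal{L}f]$ for $f\in\mathcal{D}(\mathcal{L})$, $g\in L^2(\pi)$. $\mathcal{F}:=\bigcup_{M\in\mathbb{N}}\{f>0:\ f\in\mathcal{D}(\mathcal{L}^2),\ |\log f|\le M,\ \mathcal{L}f\text{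 bounded}\}$. *)

theory Defs
  imports "HOL-Analysis.Analysis"
begin

text \<open>Configurations are extensional functions on \<open>T\<close>, with value \<open>undefined\<close> off \<open>T\<close>.\<close>

definition configs :: "'a set \<Rightarrow> ('a \<Rightarrow> nat) set" where
  "configs T = T \<rightarrow>\<^sub>E UNIV"

definition decreasing_set :: "'a set \<Rightarrow> ('a \<Rightarrow> nat) set \<Rightarrow> bool" where
  "decreasing_set T A \<longleftrightarrow> A \<subseteq> configs T \<and>
     (\<forall>\<xi>\<in>A. \<forall>\<eta>\<in>configs T. (\<forall>x\<in>T. \<eta> x \<le> \<xi> x) \<longrightarrow> \<eta> \<in> A)"

definition add_delta :: "('a \<Rightarrow> nat) \<Rightarrow> 'a \<Rightarrow> 'a \<Rightarrow> nat" where
  "add_delta \<eta> x = \<eta>(x := \<eta> x + 1)"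

text \<open>Subtraction on \<^typ>\<open>nat\<close> truncates, so this is \<open>\<eta> - \<delta>\<^sub>x\<close> only if \<open>\<eta> x > 0\<close>.\<close>

definition sub_delta :: "('a \<Rightarrow> nat) \<Rightarrow> 'a \<Rightarrow> 'a \<Rightarrow> nat" where
  "sub_delta \<eta> x = \<eta>(x := \<eta> x - 1)"

definition poisson_weight :: "'a set \<Rightarrow> ('a \<Rightarrow> real) \<Rightarrow> ('a \<Rightarrow> nat) \<Rightarrow> real" where
  "poisson_weight T \<nu> \<eta> = (\<Prod>x\<in>T. \<nu> x ^ \<eta> x / fact (\<eta> x))"

definition partition_fn :: "'a set \<Rightarrow> ('a \<Rightarrow> real) \<Rightarrow> ('a \<Rightarrow> nat) set \<Rightarrow> real" where
  "partition_fn T \<nu> A = (\<Sum>\<^sub>\<infinity>\<eta>\<in>A. poisson_weight T \<nu> \<eta>)"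

text \<open>The underlying space is \<open>A\<close>, which replaces the indicator of \<open>A\<close> in the density. Every
  subset of \<open>A\<close> is measurable and every point of \<open>A\<close> has positive mass, so functions in
  \<open>L\<^sup>2\<close> are identified with their values on \<open>A\<close>.\<close>

definition bd_measure ::
    "'a set \<Rightarrow> ('a \<Rightarrow> real) \<Rightarrow> ('a \<Rightarrow> nat) set \<Rightarrow> ('a \<Rightarrow> nat) measure" where
  "bd_measure T \<nu> A =
     point_measure A (\<lambda>\<eta>. ennreal (poisson_weight T \<nu> \<eta> / partition_fn T \<nu> A))"

definition move_plus :: "('a \<Rightarrow> nat) set \<Rightarrow> 'a \<Rightarrow> ('a \<Rightarrow> nat) \<Rightarrow> ('a \<Rightarrow> nat)" where
  "move_plus A x \<eta> = (if add_delta \<eta> x \<in> A then add_delta \<eta> x else \<eta>)"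

definition move_minus :: "('a \<Rightarrow> nat) set \<Rightarrow> 'a \<Rightarrow> ('a \<Rightarrow> nat) \<Rightarrow> ('a \<Rightarrow> nat)" where
  "move_minus A x \<eta> = (if \<eta> x > 0 \<and> sub_delta \<eta> x \<in> A then sub_delta \<eta> x else \<eta>)"

definition nabla_plus ::
    "('a \<Rightarrow> nat) set \<Rightarrow> 'a \<Rightarrow> (('a \<Rightarrow> nat) \<Rightarrow> real) \<Rightarrow> ('a \<Rightarrow> nat) \<Rightarrow> real" where
  "nabla_plus A x f \<eta> = f (move_plus A x \<eta>) - f \<eta>"

definition nabla_minus ::
    "('a \<Rightarrow> nat) set \<Rightarrow> 'a \<Rightarrow> (('a \<Rightarrow> nat) \<Rightarrow> real) \<Rightarrow> ('a \<Rightarrow> nat) \<Rightarrow> real" where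
  "nabla_minus A x f \<eta> = f (move_minus A x \<eta>) - f \<eta>"

definition bounded_functions :: "('a \<Rightarrow> nat) set \<Rightarrow> (('a \<Rightarrow> nat) \<Rightarrow> real) set" where
  "bounded_functions A = {f. bounded (f ` A)}"

definition bd_pregenerator ::
    "'a set \<Rightarrow> ('a \<Rightarrow> real) \<Rightarrow> ('a \<Rightarrow> nat) set
      \<Rightarrow> (('a \<Rightarrow> nat) \<Rightarrow> real) \<Rightarrow> ('a \<Rightarrow> nat) \<Rightarrow> real" where
  "bd_pregenerator T \<nu> A f \<eta> =
     (\<Sum>x\<in>T. real (\<eta> x) * nabla_minus A x f \<eta> + \<nu> x * nabla_plus A x f \<eta>)"

definition L2_fun :: "'b measure \<Rightarrow> ('b \<Rightarrow> real) set" where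
  "L2_fun M = {f \<in> borel_measurable M. integrable M (\<lambda>x. (f x)\<^sup>2)}"

definition L2_inner :: "'b measure \<Rightarrow> ('b \<Rightarrow> real) \<Rightarrow> ('b \<Rightarrow> real) \<Rightarrow> real" where
  "L2_inner M f g = (\<integral>x. f x * g x \<partial>M)"

text \<open>
  Let \<open>L\<close> be a symmetric operator in \<open>L\<^sup>2(M)\<close> with dense domain \<open>D\<close> such that \<open>-L\<close> is
  nonnegative. Its Friedrichs extension is the restriction of the adjoint \<open>L\<^sup>*\<close> to the elements
  of the domain of \<open>L\<^sup>*\<close> that lie in the domain of the closure of the quadratic form
  \<open>u \<mapsto> - \<langle>u, L u\<rangle>\<close> on \<open>D\<close>, that is, the \<open>L\<^sup>2\<close>-limits of sequences in \<open>D\<close> that are Cauchy for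
  this form. The predicate below is the graph of the extension.
\<close>

definition friedrichs_graph ::
    "'b measure \<Rightarrow> ('b \<Rightarrow> real) set \<Rightarrow> (('b \<Rightarrow> real) \<Rightarrow> 'b \<Rightarrow> real)
      \<Rightarrow> ('b \<Rightarrow> real) \<Rightarrow> ('b \<Rightarrow> real) \<Rightarrow> bool" where
  "friedrichs_graph M D L f h \<longleftrightarrow>
     f \<in> L2_fun M \<and> h \<in> L2_fun M \<and>
     (\<forall>g\<in>D. L2_inner M f (L g) = L2_inner M h g) \<and>
     (\<exists>u :: nat \<Rightarrow> 'b \<Rightarrow> real. (\<forall>n. u n \<in> D) \<and>
        (\<lambda>n. \<integral>x. (u n x - f x)\<^sup>2 \<partial>M) \<longlonglongrightarrow> 0 \<and>
        (\<forall>e>0. \<exists>N. \<forall>m\<ge>N. \<forall>n\<ge>N.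
           - L2_inner M (\<lambda>x. u m x - u n x) (L (\<lambda>x. u m x - u n x)) < e))"

definition friedrichs_domain ::
    "'b measure \<Rightarrow> ('b \<Rightarrow> real) set \<Rightarrow> (('b \<Rightarrow> real) \<Rightarrow> 'b \<Rightarrow> real) \<Rightarrow> ('b \<Rightarrow> real) set" where
  "friedrichs_domain M D L = {f. \<exists>h. friedrichs_graph M D L f h}"

text \<open>The choice is unique up to \<open>M\<close>-null sets, hence unique on \<open>A\<close> for \<^const>\<open>bd_measure\<close>.\<close>

definition friedrichs_op ::
    "'b measure \<Rightarrow> ('b \<Rightarrow> real) set \<Rightarrow> (('b \<Rightarrow> real) \<Rightarrow> 'b \<Rightarrow> real)
      \<Rightarrow> ('b \<Rightarrow> real) \<Rightarrow> 'b \<Rightarrow> real" where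
  "friedrichs_op M D L f = (SOME h. friedrichs_graph M D L f h)"

definition bd_domain ::
    "'a set \<Rightarrow> ('a \<Rightarrow> real) \<Rightarrow> ('a \<Rightarrow> nat) set \<Rightarrow> (('a \<Rightarrow> nat) \<Rightarrow> real) set" where
  "bd_domain T \<nu> A =
     friedrichs_domain (bd_measure T \<nu> A) (bounded_functions A) (bd_pregenerator T \<nu> A)"

definition bd_generator ::
    "'a set \<Rightarrow> ('a \<Rightarrow> real) \<Rightarrow> ('a \<Rightarrow> nat) set
      \<Rightarrow> (('a \<Rightarrow> nat) \<Rightarrow> real) \<Rightarrow> ('a \<Rightarrow> nat) \<Rightarrow> real" where
  "bd_generator T \<nu> A =
     friedrichs_op (bd_measure T \<nu> A) (bounded_functions A) (bd_pregenerator T \<nu> A)"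

definition bd_domain_sq ::
    "'a set \<Rightarrow> ('a \<Rightarrow> real) \<Rightarrow> ('a \<Rightarrow> nat) set \<Rightarrow> (('a \<Rightarrow> nat) \<Rightarrow> real) set" where
  "bd_domain_sq T \<nu> A = {f \<in> bd_domain T \<nu> A. bd_generator T \<nu> A f \<in> bd_domain T \<nu> A}"

definition dirichlet_form ::
    "'a set \<Rightarrow> ('a \<Rightarrow> real) \<Rightarrow> ('a \<Rightarrow> nat) set
      \<Rightarrow> (('a \<Rightarrow> nat) \<Rightarrow> real) \<Rightarrow> (('a \<Rightarrow> nat) \<Rightarrow> real) \<Rightarrow> real" where
  "dirichlet_form T \<nu> A f g =
     - (\<integral>\<eta>. g \<eta> * bd_generator T \<nu> A f \<eta> \<partial>bd_measure T \<nu> A)"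

definition class_F ::
    "'a set \<Rightarrow> ('a \<Rightarrow> real) \<Rightarrow> ('a \<Rightarrow> nat) set \<Rightarrow> (('a \<Rightarrow> nat) \<Rightarrow> real) set" where
  "class_F T \<nu> A =
     (\<Union>M :: nat. {f \<in> bd_domain_sq T \<nu> A. (\<forall>\<eta>\<in>A. f \<eta> > 0) \<and>
        (\<forall>\<eta>\<in>A. \<bar>ln (f \<eta>)\<bar> \<le> real M) \<and> bd_generator T \<nu> A f \<in> bounded_functions A})"

text \<open>The supremum and infimum are taken in \<^typ>\<open>ereal\<close> so that they have their usual values
  also when the index set is empty, which happens iff \<open>A\<close> contains only the zero configuration
  (assuming \<open>A\<close> is nonempty and decreasing). Otherwise both are finite.\<close>

definition eps0 :: "'a set \<Rightarrow> ('a \<Rightarrow> real) \<Rightarrow> ('a \<Rightarrow> nat) set \<Rightarrow> ereal" where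
  "eps0 T \<nu> A = (SUP (x, \<eta>) \<in> {(x, \<eta>). x \<in> T \<and> \<eta> \<in> A \<and> \<eta> x > 0}.
     ereal (\<Sum>y\<in>T - {x}. \<nu> y * of_bool (add_delta (sub_delta \<eta> x) y \<in> A)
                              * of_bool (add_delta \<eta> y \<notin> A)))"

definition eps1 :: "'a set \<Rightarrow> ('a \<Rightarrow> real) \<Rightarrow> ('a \<Rightarrow> nat) set \<Rightarrow> ereal" where
  "eps1 T \<nu> A = (INF (x, \<eta>) \<in> {(x, \<eta>). x \<in> T \<and> \<eta> \<in> A \<and> \<eta> x > 0}.
     ereal (\<nu> x * of_bool (add_delta \<eta> x \<notin> A)))"

end

theory Submission
  imports Defs
begin

text \<open>
  Write \<open>\<Phi>(u,v) = (u - v) (ln u - ln v)\<close> (\<open>pair_entropy\<close>), and call \<open>(\<zeta>, \<zeta> + \<delta>\<^sub>x)\<close> with both ends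
  in \<open>A\<close> an edge in direction \<open>x\<close>; its weight is \<open>\<pi>(\<zeta>) \<nu>(x)\<close>. Integration by parts
  (\<open>green_has_sum\<close>) shows that \<open>\<E>(f, ln f)\<close> is the weighted sum over edges of
  \<open>\<Phi>(f(\<zeta> + \<delta>\<^sub>x), f(\<zeta>))\<close>, and that the right-hand side of the theorem is the weighted sum of minus
  the derivative of \<open>\<Phi>\<close> at these pairs, in the direction \<open>(\<L>f(\<zeta> + \<delta>\<^sub>x), \<L>f(\<zeta>))\<close>. So the
  task is to show that \<open>\<E>(f, ln f)\<close> decays at rate \<open>\<kappa>\<close> along the flow of \<open>\<L>\<close>.

  The proof is a coupling argument. The function \<open>\<Phi>\<close> is convex and homogeneous of degree one,
  so its derivative at \<open>(u,v)\<close> in the direction \<open>(c - u, d - v)\<close> is at most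
  \<open>\<Phi>(c,d) - \<Phi>(u,v)\<close> (\<open>pair_entropy_deriv_step\<close>). Each joint jump of two copies of the
  chain, started at the two ends of an edge, may therefore be estimated separately
  (\<open>edge_coupling\<close>). The copies are coupled as follows, with \<open>\<eta> = \<zeta> + \<delta>\<^sub>x\<close>.

  \<^item> Deaths at rates \<open>\<zeta>(y)\<close> and births that both copies admit are made jointly; the edge moves
    to another edge in direction \<open>x\<close>.
  \<^item> The upper copy has one death \<open>\<eta> \<rightarrow> \<zeta>\<close> of rate one in excess. It is made together with a birth
    \<open>\<zeta> \<rightarrow> \<zeta> + \<delta>\<^sub>y\<close>, \<open>y \<noteq> x\<close>, that is admitted at \<open>\<zeta>\<close> and blocked at \<open>\<eta>\<close>; the new pair is again
    an edge, in direction \<open>y\<close>. The total rate of these births is at most \<open>\<epsilon>\<^sub>0 \<le> 1\<close>, so there is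
    enough excess death. What remains of the latter merges the copies.
  \<^item> A birth at \<open>x\<close> that is blocked at \<open>\<eta>\<close> merges the copies by taking \<open>\<zeta>\<close> to \<open>\<eta>\<close>.

  The copies merge at rate at least \<open>1 - \<epsilon>\<^sub>0 + \<epsilon>\<^sub>1 = \<kappa>\<close>, and \<open>\<Phi>\<close> vanishes on merged pairs. The other
  jumps contribute nothing after summation: the lower end of an edge in direction \<open>x\<close> performs,
  under the first type of jump, the birth and death chain on the decreasing set
  \<open>{\<zeta> \<in> A. \<zeta> + \<delta>\<^sub>x \<in> A}\<close>, which preserves the edge weights (\<open>edge_generator_has_sum\<close>), and
  the exchange of directions is symmetric in \<open>x\<close> and \<open>y\<close> (\<open>blocked_exchange_sum_zero\<close>).

  The Friedrichs extension enters only through its values: on bounded functions in its domain it is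
  given by the explicit formula for \<open>\<L>\<close> (\<open>bd_generator_eq\<close>), and both \<open>f\<close> and \<open>\<L>f\<close> are bounded
  for \<open>f \<in> \<F>\<close>.
\<close>

section \<open>The entropy of a pair of values\<close>

definition pair_entropy :: "real \<Rightarrow> real \<Rightarrow> real" where
  "pair_entropy u v = (u - v) * (ln u - ln v)"

text \<open>This is the derivative of \<open>pair_entropy\<close> at \<open>(u, v)\<close> in the direction \<open>(s, t)\<close>. The grouping
  matches the two integrals of the theorem: the first product comes from \<open>\<L>\<^sup>2f ln f\<close> and the
  second one from \<open>(\<L>f)\<^sup>2 / f\<close>.\<close>

definition pair_entropy_deriv :: "real \<Rightarrow> real \<Rightarrow> real \<Rightarrow> real \<Rightarrow> real" where
  "pair_entropy_deriv u v s t = (ln u - ln v) * (s - t) + (u - v) * (s / u - t / v)"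

lemma pair_entropy_nonneg:
  assumes "0 < u" "0 < v"
  shows "0 \<le> pair_entropy u v"
proof (cases "u \<le> v")
  case True
  with assms have "ln u \<le> ln v" by simp
  with True show ?thesis unfolding pair_entropy_def by (intro mult_nonpos_nonpos) auto
next
  case False
  with assms have "ln v \<le> ln u" by simp
  with False show ?thesis unfolding pair_entropy_def by (intro mult_nonneg_nonneg) auto
qed

text \<open>By homogeneity, this is the tangent plane inequality for the convex function \<open>pair_entropy\<close>.
  The difference of the two sides splits into \<open>c (ln r - 1 + 1/r)\<close> and \<open>d (r - 1 - ln r)\<close> with
  \<open>r = c v / (d u)\<close>, and both are nonnegative because \<open>ln\<close> lies below its tangent at \<open>1\<close>.\<close>

lemma pair_entropy_deriv_le:
  assumes pos: "0 < u" "0 < v" "0 < c" "0 < d"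
  shows "pair_entropy_deriv u v c d \<le> pair_entropy c d"
proof -
  define r where "r = (c * v) / (d * u)"
  have r: "0 < r" unfolding r_def using pos by simp
  have lnr: "ln r = ln c + ln v - ln d - ln u"
    unfolding r_def using pos by (simp add: ln_div ln_mult)
  have "ln (1 / r) \<le> 1 / r - 1" using r by (intro ln_le_minus_one) auto
  then have a: "0 \<le> c * (ln r - 1 + 1 / r)"
    using r pos by (intro mult_nonneg_nonneg) (auto simp: ln_div)
  have "ln r \<le> r - 1" using r by (intro ln_le_minus_one)
  then have b: "0 \<le> d * (r - 1 - ln r)" using pos by (intro mult_nonneg_nonneg) auto
  have "pair_entropy c d - pair_entropy_deriv u v c d
      = (c - d) * ln r - c - d + c * v / u + d * u / v"
    unfolding pair_entropy_def pair_entropy_deriv_def lnr using pos by (simp add: field_simps)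
  also have "\<dots> = c * (ln r - 1 + 1 / r) + d * (r - 1 - ln r)"
    using pos by (simp add: r_def field_simps)
  finally show ?thesis using a b by linarith
qed

lemma pair_entropy_deriv_step:
  assumes "0 < u" "0 < v" "0 < c" "0 < d"
  shows "pair_entropy_deriv u v (c - u) (d - v) \<le> pair_entropy c d - pair_entropy u v"
proof -
  have "pair_entropy_deriv u v (c - u) (d - v) = pair_entropy_deriv u v c d - pair_entropy u v"
    using assms unfolding pair_entropy_def pair_entropy_deriv_def by (simp add: field_simps)
  with pair_entropy_deriv_le[OF assms] show ?thesis by simp
qed

lemma pair_entropy_deriv_linear:
  "pair_entropy_deriv u v (a * s + b * s') (a * t + b * t')
    = a * pair_entropy_deriv u v s t + b * pair_entropy_deriv u v s' t'"
  unfolding pair_entropy_deriv_def by (simp add: algebra_simps add_divide_distrib)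

lemma pair_entropy_deriv_sum:
  "pair_entropy_deriv u v (\<Sum>y\<in>Y. s y) (\<Sum>y\<in>Y. t y) = (\<Sum>y\<in>Y. pair_entropy_deriv u v (s y) (t y))"
  unfolding pair_entropy_deriv_def
  by (simp add: sum.distrib sum_subtractf sum_distrib_left sum_divide_distrib algebra_simps)

section \<open>Bounded functions and unordered sums\<close>

lemma bounded_functionsE:
  assumes "u \<in> bounded_functions A"
  obtains C where "0 \<le> C" "\<And>\<eta>. \<eta> \<in> A \<Longrightarrow> \<bar>u \<eta>\<bar> \<le> C"
proof -
  from assms obtain C where "\<forall>y\<in>u ` A. norm y \<le> C"
    unfolding bounded_functions_def bounded_iff by auto
  then show ?thesis by (intro that[of "\<bar>C\<bar>"]) force+
qed

lemma bounded_functionsI: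
  "(\<And>\<eta>. \<eta> \<in> A \<Longrightarrow> \<bar>u \<eta>\<bar> \<le> C) \<Longrightarrow> u \<in> bounded_functions A"
  unfolding bounded_functions_def bounded_iff by auto

lemma bounded_functions_mult:
  assumes "u \<in> bounded_functions A" "v \<in> bounded_functions A"
  shows "(\<lambda>\<eta>. u \<eta> * v \<eta>) \<in> bounded_functions A"
proof -
  obtain C where C: "0 \<le> C" "\<And>\<eta>. \<eta> \<in> A \<Longrightarrow> \<bar>u \<eta>\<bar> \<le> C" using assms(1) by (rule bounded_functionsE) blast
  obtain D where D: "0 \<le> D" "\<And>\<eta>. \<eta> \<in> A \<Longrightarrow> \<bar>v \<eta>\<bar> \<le> D" using assms(2) by (rule bounded_functionsE) blast
  show ?thesis using C D by (intro bounded_functionsI[of _ _ "C * D"]) (auto simp: abs_mult intro!: mult_mono)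
qed

lemma bounded_functions_add:
  assumes "u \<in> bounded_functions A" "v \<in> bounded_functions A"
  shows "(\<lambda>\<eta>. u \<eta> + v \<eta>) \<in> bounded_functions A"
  using assms unfolding bounded_functions_def mem_Collect_eq by (rule bounded_plus_comp)

lemma bounded_functions_const: "(\<lambda>\<eta>. c) \<in> bounded_functions A"
  by (rule bounded_functionsI[of _ _ "\<bar>c\<bar>"]) simp

lemma bounded_functions_cmult:
  "u \<in> bounded_functions A \<Longrightarrow> (\<lambda>\<eta>. c * u \<eta>) \<in> bounded_functions A"
  by (rule bounded_functions_mult[OF bounded_functions_const])

lemma bounded_functions_sum:
  assumes "\<And>x. x \<in> T \<Longrightarrow> u x \<in> bounded_functions A"
  shows "(\<lambda>\<eta>. \<Sum>x\<in>T. u x \<eta>) \<in> bounded_functions A"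
  using assms
  by (induction T rule: infinite_finite_induct)
    (auto intro: bounded_functions_const bounded_functions_add)

lemma bounded_functions_comp:
  assumes "u \<in> bounded_functions A" "\<And>\<eta>. \<eta> \<in> A \<Longrightarrow> m \<eta> \<in> A"
  shows "(\<lambda>\<eta>. u (m \<eta>)) \<in> bounded_functions A"
proof -
  obtain C where C: "0 \<le> C" "\<And>\<eta>. \<eta> \<in> A \<Longrightarrow> \<bar>u \<eta>\<bar> \<le> C" using assms(1) by (rule bounded_functionsE) blast
  with assms(2) show ?thesis by (intro bounded_functionsI[of _ _ C]) auto
qed

lemma has_sum_diff_real:
  fixes f g :: "'b \<Rightarrow> real"
  assumes "(f has_sum a) A" "(g has_sum b) A"
  shows "((\<lambda>x. f x - g x) has_sum (a - b)) A"
  using has_sum_add[OF assms(1) has_sum_uminusI[OF assms(2)]] by simp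

lemma has_sum_finite_sum:
  fixes f :: "'c \<Rightarrow> 'b \<Rightarrow> real"
  assumes "\<And>i. i \<in> I \<Longrightarrow> (f i has_sum s i) A"
  shows "((\<lambda>x. \<Sum>i\<in>I. f i x) has_sum (\<Sum>i\<in>I. s i)) A"
  using assms
  by (induction I rule: infinite_finite_induct) (auto intro: has_sum_add)

lemma summable_on_finite_sum:
  fixes f :: "'c \<Rightarrow> 'b \<Rightarrow> real"
  assumes "\<And>i. i \<in> I \<Longrightarrow> f i summable_on A"
  shows "(\<lambda>x. \<Sum>i\<in>I. f i x) summable_on A"
  using assms
  by (induction I rule: infinite_finite_induct) (auto intro: summable_on_add)

section \<open>The birth and death chain on a decreasing set\<close>

lemma add_delta_commute: "add_delta (add_delta \<eta> x) y = add_delta (add_delta \<eta> y) x"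
  unfolding add_delta_def by (auto simp: fun_eq_iff)

lemma sub_add_delta [simp]: "sub_delta (add_delta \<eta> x) x = \<eta>"
  unfolding add_delta_def sub_delta_def by (auto simp: fun_eq_iff)

lemma add_sub_delta: "0 < \<eta> x \<Longrightarrow> add_delta (sub_delta \<eta> x) x = \<eta>"
  unfolding add_delta_def sub_delta_def by (auto simp: fun_eq_iff)

lemma sub_add_delta_commute:
  "0 < \<eta> y \<Longrightarrow> sub_delta (add_delta \<eta> x) y = add_delta (sub_delta \<eta> y) x"
  unfolding add_delta_def sub_delta_def by (auto simp: fun_eq_iff)

text \<open>The set \<open>A\<close> is a parameter of the locale because the argument uses a second instance, the set
  of lower ends of the edges in a fixed direction.\<close>

locale birth_death =
  fixes T :: "'a set" and \<nu> :: "'a \<Rightarrow> real" and A :: "('a \<Rightarrow> nat) set"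
  assumes finite_sites: "finite T"
    and decreasing: "decreasing_set T A"
    and rate_pos: "\<And>x. x \<in> T \<Longrightarrow> 0 < \<nu> x"
begin

abbreviation "p \<equiv> poisson_weight T \<nu>"
abbreviation "L \<equiv> bd_pregenerator T \<nu> A"

lemma sub_delta_mem: "\<eta> \<in> A \<Longrightarrow> x \<in> T \<Longrightarrow> sub_delta \<eta> x \<in> A"
proof -
  assume *: "\<eta> \<in> A" "x \<in> T"
  then have "\<eta> \<in> configs T" using decreasing unfolding decreasing_set_def by auto
  with * have "sub_delta \<eta> x \<in> configs T"
    unfolding configs_def sub_delta_def by (auto simp: PiE_iff extensional_def)
  moreover have "\<forall>y\<in>T. sub_delta \<eta> x y \<le> \<eta> y" unfolding sub_delta_def by auto
  ultimately show ?thesis using decreasing * unfolding decreasing_set_def by blast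
qed

lemma mem_of_add_delta_mem: "add_delta \<eta> x \<in> A \<Longrightarrow> x \<in> T \<Longrightarrow> \<eta> \<in> A"
  using sub_delta_mem[of "add_delta \<eta> x" x] by simp

lemma move_plus_mem: "\<eta> \<in> A \<Longrightarrow> move_plus A x \<eta> \<in> A"
  unfolding move_plus_def by auto

lemma move_minus_mem: "\<eta> \<in> A \<Longrightarrow> move_minus A x \<eta> \<in> A"
  unfolding move_minus_def by auto

lemma bounded_nabla_plus:
  "u \<in> bounded_functions A \<Longrightarrow> nabla_plus A x u \<in> bounded_functions A"
  using bounded_functions_add[OF bounded_functions_comp[of u A "move_plus A x"]
      bounded_functions_cmult[of u A "-1"]] move_plus_mem
  by (simp add: nabla_plus_def[abs_def])

lemma bounded_nabla_minus:
  "u \<in> bounded_functions A \<Longrightarrow> nabla_minus A x u \<in> bounded_functions A"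
  using bounded_functions_add[OF bounded_functions_comp[of u A "move_minus A x"]
      bounded_functions_cmult[of u A "-1"]] move_minus_mem
  by (simp add: nabla_minus_def[abs_def])

lemma weight_pos: "0 < p \<eta>"
  unfolding poisson_weight_def using rate_pos by (intro prod_pos) auto

lemma weight_add_delta:
  assumes "x \<in> T"
  shows "p (add_delta \<eta> x) * real (\<eta> x + 1) = p \<eta> * \<nu> x"
proof -
  have rest: "(\<Prod>y\<in>T-{x}. \<nu> y ^ add_delta \<eta> x y / fact (add_delta \<eta> x y))
      = (\<Prod>y\<in>T-{x}. \<nu> y ^ \<eta> y / fact (\<eta> y))"
    by (intro prod.cong) (auto simp: add_delta_def)
  have "add_delta \<eta> x x = Suc (\<eta> x)" by (simp add: add_delta_def)
  then show ?thesis
    unfolding poisson_weight_def prod.remove[OF finite_sites assms] rest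
    by (simp add: field_simps del: of_nat_Suc)
qed

lemma weight_summable: "p summable_on A"
proof -
  have one: "Infinite_Set_Sum.abs_summable_on (\<lambda>n::nat. \<nu> x ^ n / fact n) UNIV" if "x \<in> T" for x
  proof -
    have "summable (\<lambda>n. norm (\<nu> x ^ n / fact n))"
      using summable_norm_exp[of "\<nu> x"] by (simp add: divide_inverse mult.commute)
    then show ?thesis by (simp add: abs_summable_on_nat_iff')
  qed
  have "Infinite_Set_Sum.abs_summable_on (\<lambda>\<eta>. \<Prod>x\<in>T. \<nu> x ^ \<eta> x / fact (\<eta> x))
      (PiE T (\<lambda>_. UNIV))"
    by (rule abs_summable_on_prod_PiE[OF finite_sites]) (auto intro: one)
  then have "p summable_on (configs T)"
    unfolding configs_def poisson_weight_def[abs_def]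
    by (subst summable_on_iff_abs_summable_on_real) (simp only: abs_summable_equivalent)
  then show ?thesis
    by (rule summable_on_subset_banach) (use decreasing in \<open>auto simp: decreasing_set_def\<close>)
qed

lemma weight_bounded_summable:
  assumes "w \<in> bounded_functions A"
  shows "(\<lambda>\<eta>. p \<eta> * w \<eta>) summable_on A"
proof -
  obtain C where C: "0 \<le> C" "\<And>\<eta>. \<eta> \<in> A \<Longrightarrow> \<bar>w \<eta>\<bar> \<le> C" using assms by (rule bounded_functionsE) blast
  have "(\<lambda>\<eta>. \<bar>p \<eta> * w \<eta>\<bar>) summable_on A"
  proof (rule summable_on_comparison_test)
    show "(\<lambda>\<eta>. p \<eta> * C) summable_on A" by (intro summable_on_cmult_left weight_summable)
    show "\<bar>p \<eta> * w \<eta>\<bar> \<le> p \<eta> * C" if "\<eta> \<in> A" for \<eta>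
      using C(2)[OF that] weight_pos[of \<eta>] by (simp add: abs_mult)
  qed auto
  then show ?thesis by (subst summable_on_iff_abs_summable_on_real) simp
qed

text \<open>This is Mecke's formula for the product Poisson weight; equivalently, the detailed balance
  between deaths and births at \<open>x\<close>. Stating it for all \<open>s\<close> gives both the transfer of summability
  and the equality of the sums.\<close>

lemma mecke_has_sum:
  assumes x: "x \<in> T"
  shows "((\<lambda>\<eta>. p \<eta> * (real (\<eta> x) * F \<eta>)) has_sum s) A \<longleftrightarrow>
    ((\<lambda>\<eta>. p \<eta> * (\<nu> x * (of_bool (add_delta \<eta> x \<in> A) * F (add_delta \<eta> x)))) has_sum s) A"
    (is "(?l has_sum s) A \<longleftrightarrow> (?r has_sum s) A")
proof -
  have "(?l has_sum s) A \<longleftrightarrow> (?l has_sum s) {\<eta>\<in>A. 0 < \<eta> x}"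
    by (rule has_sum_cong_neutral) auto
  also have "\<dots> \<longleftrightarrow> (?r has_sum s) {\<zeta>\<in>A. add_delta \<zeta> x \<in> A}"
  proof (rule has_sum_reindex_bij_witness[where i = "\<lambda>\<zeta>. add_delta \<zeta> x" and j = "\<lambda>\<eta>. sub_delta \<eta> x"])
    fix \<eta> assume "\<eta> \<in> {\<eta>\<in>A. 0 < \<eta> x}"
    then have \<eta>: "\<eta> \<in> A" "add_delta (sub_delta \<eta> x) x = \<eta>" by (auto simp: add_sub_delta)
    then show "add_delta (sub_delta \<eta> x) x = \<eta>"
      and "sub_delta \<eta> x \<in> {\<zeta>\<in>A. add_delta \<zeta> x \<in> A}"
      using x by (auto simp: sub_delta_mem)
    have "real (sub_delta \<eta> x x + 1) = real (\<eta> x)"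
      using \<open>\<eta> \<in> {\<eta>\<in>A. 0 < \<eta> x}\<close> by (simp add: sub_delta_def)
    with weight_add_delta[OF x, of "sub_delta \<eta> x"] \<eta>
    have "p (sub_delta \<eta> x) * \<nu> x = p \<eta> * real (\<eta> x)" by simp
    with \<eta> show "p (sub_delta \<eta> x) * (\<nu> x * (of_bool (add_delta (sub_delta \<eta> x) x \<in> A)
        * F (add_delta (sub_delta \<eta> x) x))) = p \<eta> * (real (\<eta> x) * F \<eta>)"
      by (simp add: mult.assoc [symmetric])
  next
    fix \<zeta> assume "\<zeta> \<in> {\<zeta>\<in>A. add_delta \<zeta> x \<in> A}"
    then show "add_delta \<zeta> x \<in> {\<eta>\<in>A. 0 < \<eta> x}" by auto (simp add: add_delta_def)
  qed auto
  also have "\<dots> \<longleftrightarrow> (?r has_sum s) A"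
    by (rule has_sum_cong_neutral) auto
  finally show ?thesis .
qed

text \<open>Mecke's formula reduces the first moment of a site to the summability of the weight.\<close>

lemma weight_jump_summable:
  assumes x: "x \<in> T" and w: "w \<in> bounded_functions A"
  shows "(\<lambda>\<eta>. p \<eta> * (real (\<eta> x) * w \<eta>)) summable_on A"
proof -
  obtain C where C: "0 \<le> C" "\<And>\<eta>. \<eta> \<in> A \<Longrightarrow> \<bar>w \<eta>\<bar> \<le> C" using w by (rule bounded_functionsE) blast
  have "(\<lambda>\<eta>. \<nu> x * (of_bool (add_delta \<eta> x \<in> A) * w (add_delta \<eta> x))) \<in> bounded_functions A"
    using C by (intro bounded_functions_cmult bounded_functionsI[of _ _ C]) auto
  from weight_bounded_summable[OF this] mecke_has_sum[OF x, of w]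
  show ?thesis unfolding summable_on_def by simp
qed

lemma generator_summable:
  assumes "u \<in> bounded_functions A" "v \<in> bounded_functions A"
  shows "(\<lambda>\<eta>. p \<eta> * (u \<eta> * L v \<eta>)) summable_on A"
proof -
  have "(\<lambda>\<eta>. \<Sum>x\<in>T. p \<eta> * (real (\<eta> x) * (u \<eta> * nabla_minus A x v \<eta>))
      + p \<eta> * (\<nu> x * (u \<eta> * nabla_plus A x v \<eta>))) summable_on A"
  proof (rule summable_on_finite_sum, rule summable_on_add)
    fix x assume x: "x \<in> T"
    show "(\<lambda>\<eta>. p \<eta> * (real (\<eta> x) * (u \<eta> * nabla_minus A x v \<eta>))) summable_on A"
      by (rule weight_jump_summable[OF x bounded_functions_mult[OF assms(1) bounded_nabla_minus[OF assms(2)]]])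
    show "(\<lambda>\<eta>. p \<eta> * (\<nu> x * (u \<eta> * nabla_plus A x v \<eta>))) summable_on A"
      by (rule weight_bounded_summable[OF bounded_functions_cmult[OF
            bounded_functions_mult[OF assms(1) bounded_nabla_plus[OF assms(2)]]]])
  qed
  moreover have "p \<eta> * (u \<eta> * L v \<eta>) = (\<Sum>x\<in>T. p \<eta> * (real (\<eta> x) * (u \<eta> * nabla_minus A x v \<eta>))
      + p \<eta> * (\<nu> x * (u \<eta> * nabla_plus A x v \<eta>)))" for \<eta>
    unfolding bd_pregenerator_def sum_distrib_left by (intro sum.cong) (auto simp: algebra_simps)
  ultimately show ?thesis by simp
qed

text \<open>Only births occur, since each edge is then counted once, at its lower end.\<close>

definition energy_density :: "(('a \<Rightarrow> nat) \<Rightarrow> real) \<Rightarrow> (('a \<Rightarrow> nat) \<Rightarrow> real) \<Rightarrow> ('a \<Rightarrow> nat) \<Rightarrow> real" where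
  "energy_density u v \<eta> = (\<Sum>x\<in>T. \<nu> x * (nabla_plus A x u \<eta> * nabla_plus A x v \<eta>))"

lemma energy_density_bounded:
  assumes "u \<in> bounded_functions A" "v \<in> bounded_functions A"
  shows "energy_density u v \<in> bounded_functions A"
  unfolding energy_density_def[abs_def]
  by (rule bounded_functions_sum, rule bounded_functions_cmult, rule bounded_functions_mult)
    (use assms in \<open>auto intro: bounded_nabla_plus\<close>)

text \<open>Integration by parts: Mecke's formula, applied to \<open>u \<nabla>\<^sub>x\<^sup>- v\<close>, moves the death part of \<open>u \<L> v\<close> to
  the lower ends of the edges, where it combines with the birth part to minus a product of
  gradients. With \<open>u = 1\<close> this says that the weight is invariant.\<close>

lemma green_has_sum:
  assumes u: "u \<in> bounded_functions A" and v: "v \<in> bounded_functions A"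
  shows "((\<lambda>\<eta>. p \<eta> * (u \<eta> * L v \<eta> + energy_density u v \<eta>)) has_sum 0) A"
proof -
  have one: "((\<lambda>\<eta>. p \<eta> * (real (\<eta> x) * (u \<eta> * nabla_minus A x v \<eta>))
      - p \<eta> * (\<nu> x * (of_bool (add_delta \<eta> x \<in> A) *
         (u (add_delta \<eta> x) * nabla_minus A x v (add_delta \<eta> x))))) has_sum 0) A" if x: "x \<in> T" for x
  proof -
    let ?F = "\<lambda>\<eta>. u \<eta> * nabla_minus A x v \<eta>"
    have "?F \<in> bounded_functions A"
      by (rule bounded_functions_mult[OF u bounded_nabla_minus[OF v]])
    from weight_jump_summable[OF x this]
    obtain s where s: "((\<lambda>\<eta>. p \<eta> * (real (\<eta> x) * ?F \<eta>)) has_sum s) A"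
      unfolding summable_on_def by blast
    from has_sum_diff_real[OF s s[unfolded mecke_has_sum[OF x]]] show ?thesis by simp
  qed
  have "((\<lambda>\<eta>. \<Sum>x\<in>T. p \<eta> * (real (\<eta> x) * (u \<eta> * nabla_minus A x v \<eta>))
      - p \<eta> * (\<nu> x * (of_bool (add_delta \<eta> x \<in> A) *
         (u (add_delta \<eta> x) * nabla_minus A x v (add_delta \<eta> x))))) has_sum 0) A"
    using has_sum_finite_sum[OF one] by (simp only: sum.neutral_const)
  moreover have "p \<eta> * (u \<eta> * L v \<eta> + energy_density u v \<eta>) =
     (\<Sum>x\<in>T. p \<eta> * (real (\<eta> x) * (u \<eta> * nabla_minus A x v \<eta>))
      - p \<eta> * (\<nu> x * (of_bool (add_delta \<eta> x \<in> A) *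
         (u (add_delta \<eta> x) * nabla_minus A x v (add_delta \<eta> x)))))" if \<eta>: "\<eta> \<in> A" for \<eta>
  proof -
    have undo: "nabla_minus A x v (add_delta \<eta> x) = v \<eta> - v (add_delta \<eta> x)" for x
      using \<eta> by (simp add: nabla_minus_def move_minus_def) (simp add: add_delta_def)
    then show ?thesis
      unfolding bd_pregenerator_def energy_density_def sum_distrib_left sum.distrib[symmetric]
      by (intro sum.cong) (auto simp: undo nabla_plus_def move_plus_def algebra_simps)
  qed
  ultimately show ?thesis by (simp only: cong: has_sum_cong)
qed

lemma generator_infsum_eq_energy:
  assumes u: "u \<in> bounded_functions A" and v: "v \<in> bounded_functions A"
  shows "(\<Sum>\<^sub>\<infinity>\<eta>\<in>A. p \<eta> * (u \<eta> * L v \<eta>)) = - (\<Sum>\<^sub>\<infinity>\<eta>\<in>A. p \<eta> * energy_density u v \<eta>)"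
proof -
  have "(\<Sum>\<^sub>\<infinity>\<eta>\<in>A. p \<eta> * (u \<eta> * L v \<eta>) + p \<eta> * energy_density u v \<eta>) = 0"
    using green_has_sum[OF assms] by (simp add: has_sum_iff distrib_left)
  then show ?thesis
    using infsum_add[OF generator_summable[OF assms]
        weight_bounded_summable[OF energy_density_bounded[OF assms]]] by simp
qed

lemma generator_symmetric:
  assumes "u \<in> bounded_functions A" "v \<in> bounded_functions A"
  shows "(\<Sum>\<^sub>\<infinity>\<eta>\<in>A. p \<eta> * (u \<eta> * L v \<eta>)) = (\<Sum>\<^sub>\<infinity>\<eta>\<in>A. p \<eta> * (v \<eta> * L u \<eta>))"
  using assms by (simp add: generator_infsum_eq_energy energy_density_def mult.commute)


section \<open>The coupling of the two ends of an edge\<close>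

definition edge_base :: "'a \<Rightarrow> ('a \<Rightarrow> nat) set" where
  "edge_base x = {\<zeta>\<in>A. add_delta \<zeta> x \<in> A}"

definition edge_entropy :: "(('a \<Rightarrow> nat) \<Rightarrow> real) \<Rightarrow> 'a \<Rightarrow> ('a \<Rightarrow> nat) \<Rightarrow> real" where
  "edge_entropy f x \<zeta> = pair_entropy (f (add_delta \<zeta> x)) (f \<zeta>)"

text \<open>The rate of the birth at \<open>y\<close> if \<open>\<zeta>\<close> admits it and \<open>\<zeta> + \<delta>\<^sub>x\<close> does not. With
  \<open>\<eta> = \<zeta> + \<delta>\<^sub>x\<close>, the sum over \<open>y \<noteq> x\<close> is the quantity whose supremum is \<open>\<epsilon>\<^sub>0\<close>.\<close>

definition blocked_rate :: "'a \<Rightarrow> 'a \<Rightarrow> ('a \<Rightarrow> nat) \<Rightarrow> real" where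
  "blocked_rate x y \<zeta> =
     \<nu> y * of_bool (add_delta \<zeta> y \<in> A) * of_bool (add_delta (add_delta \<zeta> x) y \<notin> A)"

text \<open>The two ends merge by the part of the excess death at \<open>x\<close> that is not coupled with a blocked
  birth, and by the birth at \<open>x\<close> if only the lower end admits it.\<close>

definition merging_rate :: "'a \<Rightarrow> ('a \<Rightarrow> nat) \<Rightarrow> real" where
  "merging_rate x \<zeta> = 1 - (\<Sum>y\<in>T-{x}. blocked_rate x y \<zeta>)
     + \<nu> x * of_bool (add_delta (add_delta \<zeta> x) x \<notin> A)"

text \<open>Adding \<open>\<delta>\<^sub>x\<close> preserves the order. Joint moves of the two ends keep the direction of an edge, so
  they amount to a birth and death chain of its lower end, and the results above apply to it.\<close>

lemma birth_death_edge_base: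
  assumes x: "x \<in> T"
  shows "birth_death T \<nu> (edge_base x)"
proof
  show "finite T" by (rule finite_sites)
  show "0 < \<nu> y" if "y \<in> T" for y using that by (rule rate_pos)
  have A: "A \<subseteq> configs T" "\<And>\<xi> \<eta>. \<xi> \<in> A \<Longrightarrow> \<eta> \<in> configs T \<Longrightarrow> \<forall>x\<in>T. \<eta> x \<le> \<xi> x \<Longrightarrow> \<eta> \<in> A"
    using decreasing unfolding decreasing_set_def by blast+
  show "decreasing_set T (edge_base x)"
    unfolding decreasing_set_def
  proof (intro conjI ballI impI)
    show "edge_base x \<subseteq> configs T" using A(1) by (auto simp: edge_base_def)
    fix \<xi> \<eta> assume \<xi>: "\<xi> \<in> edge_base x" and \<eta>: "\<eta> \<in> configs T" and le: "\<forall>y\<in>T. \<eta> y \<le> \<xi> y"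
    have "add_delta \<eta> x \<in> configs T"
      using \<eta> x unfolding configs_def add_delta_def by (auto simp: PiE_iff extensional_def)
    moreover have "\<forall>y\<in>T. add_delta \<eta> x y \<le> add_delta \<xi> x y"
      using le unfolding add_delta_def by auto
    ultimately show "\<eta> \<in> edge_base x"
      using A(2)[OF _ \<eta> le] A(2)[of "add_delta \<xi> x" "add_delta \<eta> x"] \<xi> by (simp add: edge_base_def)
  qed
qed

text \<open>The derivative is linear in its direction, so it splits over the jumps of the coupled pair, and
  convexity bounds each jump by the increment of the entropy of the pair. The three terms on the right
  belong to the joint moves, to the excess death coupled with a blocked birth, and to the merging.\<close>

lemma edge_coupling:
  assumes x: "x \<in> T" and \<zeta>: "\<zeta> \<in> edge_base x"
    and pos: "\<And>\<eta>. \<eta> \<in> A \<Longrightarrow> 0 < f \<eta>"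
    and blocked: "(\<Sum>y\<in>T-{x}. blocked_rate x y \<zeta>) \<le> 1"
  shows "pair_entropy_deriv (f (add_delta \<zeta> x)) (f \<zeta>) (L f (add_delta \<zeta> x)) (L f \<zeta>)
    \<le> bd_pregenerator T \<nu> (edge_base x) (edge_entropy f x) \<zeta>
      + (\<Sum>y\<in>T-{x}. blocked_rate x y \<zeta> * (edge_entropy f y \<zeta> - edge_entropy f x \<zeta>))
      - merging_rate x \<zeta> * edge_entropy f x \<zeta>"
proof -
  let ?\<eta> = "add_delta \<zeta> x"
  let ?J = "pair_entropy_deriv (f ?\<eta>) (f \<zeta>)"
  let ?\<Phi> = "edge_entropy f x"
  let ?B = "edge_base x"
  \<comment> \<open>\<open>D\<close> is the contribution of the excess death at \<open>x\<close>, if the lower end stays put.\<close>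
  define D where "D = ?J (f \<zeta> - f ?\<eta>) 0"
  define s where "s \<sigma> y = real (\<sigma> y) * nabla_minus A y f \<sigma> + \<nu> y * nabla_plus A y f \<sigma>" for \<sigma> y
  define l where "l y = real (\<zeta> y) * nabla_minus ?B y ?\<Phi> \<zeta> + \<nu> y * nabla_plus ?B y ?\<Phi> \<zeta>" for y
  have mem: "\<zeta> \<in> A" "?\<eta> \<in> A" using \<zeta> by (auto simp: edge_base_def)
  note posm = pos[OF mem(1)] pos[OF mem(2)]
  have step: "?J (c - f ?\<eta>) (d - f \<zeta>) \<le> pair_entropy c d - ?\<Phi> \<zeta>" if "0 < c" "0 < d" for c d
    unfolding edge_entropy_def using posm that by (intro pair_entropy_deriv_step)
  have D: "D \<le> - ?\<Phi> \<zeta>"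
    using step[of "f \<zeta>" "f \<zeta>"] posm by (simp add: D_def pair_entropy_def)
  have death: "real (\<zeta> y) * ?J (f (sub_delta ?\<eta> y) - f ?\<eta>) (nabla_minus A y f \<zeta>)
      \<le> real (\<zeta> y) * nabla_minus ?B y ?\<Phi> \<zeta>" if y: "y \<in> T" for y
  proof (cases "\<zeta> y = 0")
    case False
    then have sub: "sub_delta ?\<eta> y = add_delta (sub_delta \<zeta> y) x" by (intro sub_add_delta_commute) auto
    have mem': "sub_delta \<zeta> y \<in> A" "sub_delta ?\<eta> y \<in> A" using mem y by (auto intro: sub_delta_mem)
    then have "sub_delta \<zeta> y \<in> ?B" by (simp add: edge_base_def sub)
    then have "nabla_minus ?B y ?\<Phi> \<zeta> = ?\<Phi> (sub_delta \<zeta> y) - ?\<Phi> \<zeta>"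
      using False by (simp add: nabla_minus_def move_minus_def)
    moreover have "nabla_minus A y f \<zeta> = f (sub_delta \<zeta> y) - f \<zeta>"
      using False mem' by (simp add: nabla_minus_def move_minus_def)
    ultimately show ?thesis
      using step[OF pos[OF mem'(2)] pos[OF mem'(1)]]
      by (intro mult_left_mono) (auto simp: edge_entropy_def sub)
  qed simp
  have both: "?J (nabla_plus A y f ?\<eta>) (nabla_plus A y f \<zeta>) \<le> nabla_plus ?B y ?\<Phi> \<zeta>"
    if y: "y \<in> T" and or: "add_delta ?\<eta> y \<in> A \<or> add_delta \<zeta> y \<notin> A" for y
  proof (cases "add_delta ?\<eta> y \<in> A")
    case True
    then have mem': "add_delta \<zeta> y \<in> A"
      using mem_of_add_delta_mem[of "add_delta \<zeta> y" x] x by (simp add: add_delta_commute)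
    with True have "add_delta \<zeta> y \<in> ?B" by (simp add: edge_base_def add_delta_commute)
    with True mem' step[OF pos[OF True] pos[OF mem']] show ?thesis
      by (simp add: nabla_plus_def move_plus_def edge_entropy_def add_delta_commute)
  next
    case False
    with or have "add_delta \<zeta> y \<notin> A" "add_delta \<zeta> y \<notin> ?B" by (auto simp: edge_base_def)
    with False show ?thesis
      by (simp add: nabla_plus_def move_plus_def pair_entropy_deriv_def)
  qed
  have not_B: "nabla_plus ?B y ?\<Phi> \<zeta> = 0" if "add_delta ?\<eta> y \<notin> A" for y
    using that by (simp add: nabla_plus_def move_plus_def edge_base_def add_delta_commute)
  \<comment> \<open>A blocked birth borrows its share of the excess death; the debt \<open>blocked_rate x y \<zeta> * D\<close> is
    settled by the \<open>D\<close> in the site \<open>x\<close>.\<close>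
  have off: "?J (s ?\<eta> y) (s \<zeta> y) \<le> l y
      + blocked_rate x y \<zeta> * (edge_entropy f y \<zeta> - ?\<Phi> \<zeta>) - blocked_rate x y \<zeta> * D"
    if y: "y \<in> T - {x}" for y
  proof -
    have "?\<eta> y = \<zeta> y" using y by (simp add: add_delta_def)
    moreover have "nabla_minus A y f ?\<eta> = f (sub_delta ?\<eta> y) - f ?\<eta> \<or> \<zeta> y = 0"
      using y mem \<open>?\<eta> y = \<zeta> y\<close> by (auto simp: nabla_minus_def move_minus_def sub_delta_mem)
    ultimately have "?J (s ?\<eta> y) (s \<zeta> y)
        = real (\<zeta> y) * ?J (f (sub_delta ?\<eta> y) - f ?\<eta>) (nabla_minus A y f \<zeta>)
          + \<nu> y * ?J (nabla_plus A y f ?\<eta>) (nabla_plus A y f \<zeta>)"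
      unfolding s_def pair_entropy_deriv_linear[symmetric] by auto
    with death[of y] y have "?J (s ?\<eta> y) (s \<zeta> y) \<le> real (\<zeta> y) * nabla_minus ?B y ?\<Phi> \<zeta>
        + \<nu> y * ?J (nabla_plus A y f ?\<eta>) (nabla_plus A y f \<zeta>)"
      by simp
    moreover have "\<nu> y * ?J (nabla_plus A y f ?\<eta>) (nabla_plus A y f \<zeta>)
       \<le> \<nu> y * nabla_plus ?B y ?\<Phi> \<zeta>
         + blocked_rate x y \<zeta> * (edge_entropy f y \<zeta> - ?\<Phi> \<zeta>) - blocked_rate x y \<zeta> * D"
    proof (cases "add_delta ?\<eta> y \<in> A \<or> add_delta \<zeta> y \<notin> A")
      case True
      then have "blocked_rate x y \<zeta> = 0" by (auto simp: blocked_rate_def)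
      with both[OF _ True] y rate_pos[of y] show ?thesis by simp
    next
      case False
      then have "?J (nabla_plus A y f ?\<eta>) (nabla_plus A y f \<zeta>)
          = ?J (f \<zeta> - f ?\<eta>) (f (add_delta \<zeta> y) - f \<zeta>) - D"
        by (simp add: nabla_plus_def move_plus_def D_def pair_entropy_deriv_def
            algebra_simps diff_divide_distrib)
      also have "\<dots> \<le> pair_entropy (f \<zeta>) (f (add_delta \<zeta> y)) - ?\<Phi> \<zeta> - D"
        using step[OF posm(1) pos[of "add_delta \<zeta> y"]] False by simp
      also have "pair_entropy (f \<zeta>) (f (add_delta \<zeta> y)) = edge_entropy f y \<zeta>"
        by (simp add: edge_entropy_def pair_entropy_def algebra_simps)
      finally have "\<nu> y * ?J (nabla_plus A y f ?\<eta>) (nabla_plus A y f \<zeta>)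
          \<le> \<nu> y * (edge_entropy f y \<zeta> - ?\<Phi> \<zeta> - D)"
        using rate_pos[of y] y by (intro mult_left_mono) auto
      moreover have "blocked_rate x y \<zeta> = \<nu> y" using False by (simp add: blocked_rate_def)
      ultimately show ?thesis using not_B False by (simp add: algebra_simps)
    qed
    ultimately show ?thesis unfolding l_def by linarith
  qed
  \<comment> \<open>At the site \<open>x\<close> itself the upper end has one particle more, which gives the extra \<open>D\<close>.\<close>
  have diag: "?J (s ?\<eta> x) (s \<zeta> x)
      \<le> l x + D - \<nu> x * of_bool (add_delta ?\<eta> x \<notin> A) * ?\<Phi> \<zeta>"
  proof -
    have "nabla_minus A x f ?\<eta> = f \<zeta> - f ?\<eta>"
      using mem by (simp add: nabla_minus_def move_minus_def) (simp add: add_delta_def)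
    then have "s ?\<eta> x = real (\<zeta> x) * (f (sub_delta ?\<eta> x) - f ?\<eta>)
        + 1 * (1 * (f \<zeta> - f ?\<eta>) + \<nu> x * nabla_plus A x f ?\<eta>)"
      unfolding s_def sub_add_delta by (simp add: add_delta_def) (simp add: distrib_right)
    moreover have "s \<zeta> x = real (\<zeta> x) * nabla_minus A x f \<zeta>
        + 1 * (1 * 0 + \<nu> x * nabla_plus A x f \<zeta>)"
      unfolding s_def by simp
    ultimately have "?J (s ?\<eta> x) (s \<zeta> x)
        = real (\<zeta> x) * ?J (f (sub_delta ?\<eta> x) - f ?\<eta>) (nabla_minus A x f \<zeta>)
          + D + \<nu> x * ?J (nabla_plus A x f ?\<eta>) (nabla_plus A x f \<zeta>)"
      by (simp only: pair_entropy_deriv_linear D_def) simp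
    moreover have "\<nu> x * ?J (nabla_plus A x f ?\<eta>) (nabla_plus A x f \<zeta>)
       \<le> \<nu> x * nabla_plus ?B x ?\<Phi> \<zeta> - \<nu> x * of_bool (add_delta ?\<eta> x \<notin> A) * ?\<Phi> \<zeta>"
    proof (cases "add_delta ?\<eta> x \<in> A")
      case True
      with both[OF x] rate_pos[OF x] show ?thesis by simp
    next
      case False
      have "?J 0 (f ?\<eta> - f \<zeta>) \<le> - ?\<Phi> \<zeta>"
        using step[OF posm(2) posm(2)] by (simp add: pair_entropy_def)
      then have "\<nu> x * ?J 0 (f ?\<eta> - f \<zeta>) \<le> \<nu> x * - ?\<Phi> \<zeta>"
        using rate_pos[OF x] by (intro mult_left_mono) auto
      moreover have "nabla_plus A x f ?\<eta> = 0" "nabla_plus A x f \<zeta> = f ?\<eta> - f \<zeta>"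
        using False mem by (auto simp: nabla_plus_def move_plus_def)
      ultimately show ?thesis using False not_B[OF False] by simp
    qed
    ultimately show ?thesis using death[OF x] unfolding l_def by linarith
  qed
  have "?J (L f ?\<eta>) (L f \<zeta>) = (\<Sum>y\<in>T. ?J (s ?\<eta> y) (s \<zeta> y))"
    unfolding bd_pregenerator_def s_def[symmetric] by (rule pair_entropy_deriv_sum)
  also have "\<dots> = ?J (s ?\<eta> x) (s \<zeta> x) + (\<Sum>y\<in>T-{x}. ?J (s ?\<eta> y) (s \<zeta> y))"
    using finite_sites x by (rule sum.remove)
  also have "\<dots> \<le> (l x + D - \<nu> x * of_bool (add_delta ?\<eta> x \<notin> A) * ?\<Phi> \<zeta>)
     + (\<Sum>y\<in>T-{x}. l y + blocked_rate x y \<zeta> * (edge_entropy f y \<zeta> - ?\<Phi> \<zeta>) - blocked_rate x y \<zeta> * D)"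
    by (intro add_mono diag sum_mono off)
  also have "\<dots> = (\<Sum>y\<in>T. l y)
      + (\<Sum>y\<in>T-{x}. blocked_rate x y \<zeta> * (edge_entropy f y \<zeta> - ?\<Phi> \<zeta>))
      + (1 - (\<Sum>y\<in>T-{x}. blocked_rate x y \<zeta>)) * D - \<nu> x * of_bool (add_delta ?\<eta> x \<notin> A) * ?\<Phi> \<zeta>"
    using sum.remove[OF finite_sites x, of l]
    by (simp add: sum.distrib sum_subtractf sum_distrib_right left_diff_distrib)
  \<comment> \<open>The excess death that is left has nonnegative rate by \<open>blocked\<close>, so \<open>D\<close> may be estimated.\<close>
  also have "\<dots> \<le> (\<Sum>y\<in>T. l y)
      + (\<Sum>y\<in>T-{x}. blocked_rate x y \<zeta> * (edge_entropy f y \<zeta> - ?\<Phi> \<zeta>))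
      + (1 - (\<Sum>y\<in>T-{x}. blocked_rate x y \<zeta>)) * (- ?\<Phi> \<zeta>)
      - \<nu> x * of_bool (add_delta ?\<eta> x \<notin> A) * ?\<Phi> \<zeta>"
    using mult_left_mono[OF D, of "1 - (\<Sum>y\<in>T-{x}. blocked_rate x y \<zeta>)"] blocked by simp
  also have "\<dots> = (\<Sum>y\<in>T. l y)
      + (\<Sum>y\<in>T-{x}. blocked_rate x y \<zeta> * (edge_entropy f y \<zeta> - ?\<Phi> \<zeta>))
      - merging_rate x \<zeta> * ?\<Phi> \<zeta>"
    unfolding merging_rate_def by (simp add: algebra_simps)
  finally show ?thesis unfolding l_def bd_pregenerator_def .
qed

text \<open>The condition that \<open>\<zeta> + \<delta>\<^sub>x\<close> and \<open>\<zeta> + \<delta>\<^sub>y\<close> lie in \<open>A\<close> and \<open>\<zeta> + \<delta>\<^sub>x + \<delta>\<^sub>y\<close> does not is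
  symmetric in \<open>x\<close> and \<open>y\<close>, so the summand is antisymmetric.\<close>

lemma blocked_exchange_sum_zero:
  "(\<Sum>x\<in>T. \<nu> x * of_bool (add_delta \<zeta> x \<in> A) *
      (\<Sum>y\<in>T-{x}. blocked_rate x y \<zeta> * (edge_entropy f y \<zeta> - edge_entropy f x \<zeta>))) = 0"
proof -
  define c where "c x y = \<nu> x * of_bool (add_delta \<zeta> x \<in> A) * blocked_rate x y \<zeta>
    * (edge_entropy f y \<zeta> - edge_entropy f x \<zeta>)" for x y
  have anti: "c x y = - c y x" for x y
    by (simp add: c_def blocked_rate_def add_delta_commute algebra_simps)
  have "(\<Sum>y\<in>T-{x}. c x y) = (\<Sum>y\<in>T. c x y)" if "x \<in> T" for x
    using sum.remove[OF finite_sites that, of "c x"] anti[of x x] by simp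
  moreover have "(\<Sum>x\<in>T. \<Sum>y\<in>T. c x y) = (\<Sum>x\<in>T. \<Sum>y\<in>T. - c x y)"
    by (subst sum.swap) (intro sum.cong refl anti)
  ultimately have "(\<Sum>x\<in>T. \<Sum>y\<in>T-{x}. c x y) = 0" by (simp add: sum_negf)
  then show ?thesis by (simp add: c_def sum_distrib_left mult.assoc)
qed


text \<open>Integration by parts on \<open>edge_base x\<close> against the constant \<open>1\<close>: since the joint moves preserve the
  weights of the edges, they do not change the total entropy to first order.\<close>

lemma edge_generator_has_sum:
  assumes f: "f \<in> bounded_functions A" and lnf: "(\<lambda>\<eta>. ln (f \<eta>)) \<in> bounded_functions A"
  shows "((\<lambda>\<zeta>. p \<zeta> * (\<Sum>x\<in>T. \<nu> x * of_bool (add_delta \<zeta> x \<in> A) *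
      bd_pregenerator T \<nu> (edge_base x) (edge_entropy f x) \<zeta>)) has_sum 0) A"
proof -
  define F where "F x \<zeta> = p \<zeta> * (of_bool (add_delta \<zeta> x \<in> A) *
      bd_pregenerator T \<nu> (edge_base x) (edge_entropy f x) \<zeta>)" for x \<zeta>
  have one: "(F x has_sum 0) A" if x: "x \<in> T" for x
  proof -
    interpret E: birth_death T \<nu> "edge_base x" by (rule birth_death_edge_base[OF x])
    obtain C where C: "\<And>\<eta>. \<eta> \<in> A \<Longrightarrow> \<bar>f \<eta>\<bar> \<le> C" using f by (rule bounded_functionsE) blast
    obtain D where D: "\<And>\<eta>. \<eta> \<in> A \<Longrightarrow> \<bar>ln (f \<eta>)\<bar> \<le> D" using lnf by (rule bounded_functionsE) blast
    have "edge_entropy f x \<in> bounded_functions (edge_base x)"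
    proof (rule bounded_functionsI)
      fix \<zeta> assume "\<zeta> \<in> edge_base x"
      then have "\<zeta> \<in> A" "add_delta \<zeta> x \<in> A" by (auto simp: edge_base_def)
      note * = C[OF this(1)] C[OF this(2)] D[OF this(1)] D[OF this(2)]
      show "\<bar>edge_entropy f x \<zeta>\<bar> \<le> (2 * C) * (2 * D)"
        unfolding edge_entropy_def pair_entropy_def abs_mult
        by (rule mult_mono) (use * in linarith)+
    qed
    from E.green_has_sum[OF bounded_functions_const[of 1] this]
    have "((\<lambda>\<zeta>. p \<zeta> * bd_pregenerator T \<nu> (edge_base x) (edge_entropy f x) \<zeta>) has_sum 0) (edge_base x)"
      by (simp add: E.energy_density_def nabla_plus_def)
    moreover have "(F x has_sum 0) A \<longleftrightarrow>
      ((\<lambda>\<zeta>. p \<zeta> * bd_pregenerator T \<nu> (edge_base x) (edge_entropy f x) \<zeta>) has_sum 0) (edge_base x)"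
      by (rule has_sum_cong_neutral) (auto simp: edge_base_def F_def)
    ultimately show "(F x has_sum 0) A" by (rule iffD2[rotated])
  qed
  have "((\<lambda>\<zeta>. \<nu> x * F x \<zeta>) has_sum 0) A" if "x \<in> T" for x
    using has_sum_cmult_right[OF one[OF that], of "\<nu> x"] by simp
  then have total: "((\<lambda>\<zeta>. \<Sum>x\<in>T. \<nu> x * F x \<zeta>) has_sum 0) A"
    using has_sum_finite_sum[where I = T and f = "\<lambda>x \<zeta>. \<nu> x * F x \<zeta>" and s = "\<lambda>_. 0"] by simp
  have regroup: "p \<zeta> * (\<Sum>x\<in>T. \<nu> x * of_bool (add_delta \<zeta> x \<in> A) *
      bd_pregenerator T \<nu> (edge_base x) (edge_entropy f x) \<zeta>) = (\<Sum>x\<in>T. \<nu> x * F x \<zeta>)" for \<zeta>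
    unfolding sum_distrib_left F_def by (intro sum.cong refl) (simp add: mult.assoc mult.left_commute)
  show ?thesis using total by (subst regroup)
qed

section \<open>The entropy inequality\<close>

text \<open>All terms are brought to the form of an edge sum by integration by parts. The term \<open>\<L>\<^sup>2f ln f\<close>
  becomes the product of the gradients of \<open>\<L>f\<close> and \<open>ln f\<close>. The square in \<open>(\<L>f)\<^sup>2 / f\<close> is read as the
  bounded function \<open>\<L>f / f\<close> times \<open>\<L>f\<close>, and gives the product of the gradients of \<open>\<L>f / f\<close> and \<open>f\<close>.
  On each edge the two products add up to \<open>pair_entropy_deriv\<close>.\<close>

lemma entropy_convexity_infsum:
  assumes pos: "\<And>\<eta>. \<eta> \<in> A \<Longrightarrow> 0 < f \<eta>"
    and f: "f \<in> bounded_functions A" and l: "(\<lambda>\<eta>. ln (f \<eta>)) \<in> bounded_functions A"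
    and q: "(\<lambda>\<eta>. g \<eta> / f \<eta>) \<in> bounded_functions A"
    and g: "g \<in> bounded_functions A" and g_eq: "\<And>\<eta>. \<eta> \<in> A \<Longrightarrow> g \<eta> = L f \<eta>"
    and blocked: "\<And>x \<zeta>. x \<in> T \<Longrightarrow> \<zeta> \<in> edge_base x \<Longrightarrow> (\<Sum>y\<in>T-{x}. blocked_rate x y \<zeta>) \<le> 1"
    and k: "\<And>x \<zeta>. x \<in> T \<Longrightarrow> \<zeta> \<in> edge_base x \<Longrightarrow> k \<le> merging_rate x \<zeta>"
  shows "k * - (\<Sum>\<^sub>\<infinity>\<eta>\<in>A. p \<eta> * (ln (f \<eta>) * L f \<eta>))
    \<le> (\<Sum>\<^sub>\<infinity>\<eta>\<in>A. p \<eta> * (ln (f \<eta>) * L g \<eta>)) + (\<Sum>\<^sub>\<infinity>\<eta>\<in>A. p \<eta> * (g \<eta> / f \<eta> * L f \<eta>))"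
proof -
  let ?l = "\<lambda>\<eta>. ln (f \<eta>)"
  let ?q = "\<lambda>\<eta>. g \<eta> / f \<eta>"
  let ?G = "\<lambda>\<zeta>. \<Sum>x\<in>T. \<nu> x * of_bool (add_delta \<zeta> x \<in> A) *
      bd_pregenerator T \<nu> (edge_base x) (edge_entropy f x) \<zeta>"
  let ?R = "\<lambda>\<zeta>. energy_density ?l g \<zeta> + energy_density ?q f \<zeta>"
  have R_summable: "(\<lambda>\<zeta>. p \<zeta> * ?R \<zeta>) summable_on A"
    by (rule weight_bounded_summable[OF bounded_functions_add[OF
          energy_density_bounded[OF l g] energy_density_bounded[OF q f]]])
  have E_summable: "(\<lambda>\<zeta>. p \<zeta> * energy_density ?l f \<zeta>) summable_on A"
    by (rule weight_bounded_summable[OF energy_density_bounded[OF l f]])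
  note G = edge_generator_has_sum[OF f l]
  have pointwise: "?R \<zeta> \<le> ?G \<zeta> - k * energy_density ?l f \<zeta>" if \<zeta>: "\<zeta> \<in> A" for \<zeta>
  proof -
    let ?J = "\<lambda>x. pair_entropy_deriv (f (add_delta \<zeta> x)) (f \<zeta>) (L f (add_delta \<zeta> x)) (L f \<zeta>)"
    let ?w = "\<lambda>x. \<nu> x * of_bool (add_delta \<zeta> x \<in> A)"
    let ?X = "\<lambda>x. \<Sum>y\<in>T-{x}. blocked_rate x y \<zeta> * (edge_entropy f y \<zeta> - edge_entropy f x \<zeta>)"
    have "?R \<zeta> = (\<Sum>x\<in>T. ?w x * ?J x)"
      unfolding energy_density_def sum.distrib[symmetric]
    proof (rule sum.cong)
      fix x
      show "\<nu> x * (nabla_plus A x ?l \<zeta> * nabla_plus A x g \<zeta>)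
          + \<nu> x * (nabla_plus A x ?q \<zeta> * nabla_plus A x f \<zeta>) = ?w x * ?J x"
        using \<zeta> by (cases "add_delta \<zeta> x \<in> A")
          (auto simp: nabla_plus_def move_plus_def pair_entropy_deriv_def g_eq algebra_simps)
    qed simp
    also have "\<dots> \<le> (\<Sum>x\<in>T. ?w x * (bd_pregenerator T \<nu> (edge_base x) (edge_entropy f x) \<zeta>
        + ?X x - k * edge_entropy f x \<zeta>))"
    proof (rule sum_mono)
      fix x assume x: "x \<in> T"
      show "?w x * ?J x \<le> ?w x * (bd_pregenerator T \<nu> (edge_base x) (edge_entropy f x) \<zeta>
          + ?X x - k * edge_entropy f x \<zeta>)"
      proof (cases "add_delta \<zeta> x \<in> A")
        case True
        with \<zeta> have e: "\<zeta> \<in> edge_base x" by (simp add: edge_base_def)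
        have "0 \<le> edge_entropy f x \<zeta>"
          unfolding edge_entropy_def using pos \<zeta> True by (intro pair_entropy_nonneg) auto
        from mult_right_mono[OF k[OF x e] this] edge_coupling[where f = f, OF x e pos blocked[OF x e]]
        have "?J x \<le> bd_pregenerator T \<nu> (edge_base x) (edge_entropy f x) \<zeta>
          + ?X x - k * edge_entropy f x \<zeta>" by linarith
        then show ?thesis using rate_pos[OF x] True by simp
      qed simp
    qed
    also have "\<dots> = ?G \<zeta> + (\<Sum>x\<in>T. ?w x * ?X x) - k * (\<Sum>x\<in>T. ?w x * edge_entropy f x \<zeta>)"
      unfolding sum_distrib_left[of k] sum.distrib[symmetric] sum_subtractf[symmetric]
      by (intro sum.cong) (auto simp: distrib_left right_diff_distrib)
    also have "(\<Sum>x\<in>T. ?w x * ?X x) = 0" by (rule blocked_exchange_sum_zero)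
    also have "(\<Sum>x\<in>T. ?w x * edge_entropy f x \<zeta>) = energy_density ?l f \<zeta>"
      unfolding energy_density_def
      by (intro sum.cong) (auto simp: nabla_plus_def move_plus_def edge_entropy_def pair_entropy_def)
    finally show ?thesis by simp
  qed
  have "(\<Sum>\<^sub>\<infinity>\<zeta>\<in>A. p \<zeta> * ?R \<zeta>) \<le> 0 - k * (\<Sum>\<^sub>\<infinity>\<zeta>\<in>A. p \<zeta> * energy_density ?l f \<zeta>)"
  proof (rule has_sum_mono)
    show "((\<lambda>\<zeta>. p \<zeta> * ?R \<zeta>) has_sum (\<Sum>\<^sub>\<infinity>\<zeta>\<in>A. p \<zeta> * ?R \<zeta>)) A"
      using R_summable by (rule has_sum_infsum)
    show "((\<lambda>\<zeta>. p \<zeta> * ?G \<zeta> - k * (p \<zeta> * energy_density ?l f \<zeta>)) has_sum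
        (0 - k * (\<Sum>\<^sub>\<infinity>\<zeta>\<in>A. p \<zeta> * energy_density ?l f \<zeta>))) A"
      by (intro has_sum_diff_real G has_sum_cmult_right has_sum_infsum E_summable)
    show "p \<zeta> * ?R \<zeta> \<le> p \<zeta> * ?G \<zeta> - k * (p \<zeta> * energy_density ?l f \<zeta>)" if "\<zeta> \<in> A" for \<zeta>
      using mult_left_mono[OF pointwise[OF that], of "p \<zeta>"] weight_pos[of \<zeta>]
      by (simp add: right_diff_distrib mult_ac)
  qed
  moreover have "(\<Sum>\<^sub>\<infinity>\<zeta>\<in>A. p \<zeta> * ?R \<zeta>)
      = (\<Sum>\<^sub>\<infinity>\<zeta>\<in>A. p \<zeta> * energy_density ?l g \<zeta>) + (\<Sum>\<^sub>\<infinity>\<zeta>\<in>A. p \<zeta> * energy_density ?q f \<zeta>)"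
    unfolding distrib_left
    by (rule infsum_add[OF weight_bounded_summable[OF energy_density_bounded[OF l g]]
          weight_bounded_summable[OF energy_density_bounded[OF q f]]])
  ultimately show ?thesis
    using generator_infsum_eq_energy[OF l f] generator_infsum_eq_energy[OF l g]
      generator_infsum_eq_energy[OF q f] by simp
qed

section \<open>Integrals and the Friedrichs extension\<close>

lemma partition_fn_pos:
  assumes "A \<noteq> {}"
  shows "0 < partition_fn T \<nu> A"
proof -
  obtain \<eta> where \<eta>: "\<eta> \<in> A" using assms by blast
  have "sum p {\<eta>} \<le> infsum p A"
    using \<eta> weight_pos by (intro finite_sum_le_infsum weight_summable) (auto intro: less_imp_le)
  with weight_pos[of \<eta>] show ?thesis unfolding partition_fn_def by simp
qed

lemma integral_bd_measure:
  assumes "(\<lambda>\<eta>. p \<eta> * F \<eta>) summable_on A"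
  shows "(\<integral>\<eta>. F \<eta> \<partial>bd_measure T \<nu> A) = (\<Sum>\<^sub>\<infinity>\<eta>\<in>A. p \<eta> * F \<eta>) / partition_fn T \<nu> A"
proof -
  let ?Z = "partition_fn T \<nu> A"
  have Z: "0 \<le> ?Z" unfolding partition_fn_def using weight_pos by (intro infsum_nonneg) (auto intro: less_imp_le)
  have "(\<lambda>\<eta>. p \<eta> * F \<eta> * (1 / ?Z)) summable_on A" using assms by (rule summable_on_cmult_left)
  then have "Infinite_Set_Sum.abs_summable_on (\<lambda>\<eta>. p \<eta> * F \<eta> * (1 / ?Z)) A"
    by (simp only: summable_on_iff_abs_summable_on_real[of "\<lambda>\<eta>. p \<eta> * F \<eta> * (1 / ?Z)"]
        abs_summable_equivalent)
  then have "infsetsum (\<lambda>\<eta>. p \<eta> * F \<eta> * (1 / ?Z)) A = (\<Sum>\<^sub>\<infinity>\<eta>\<in>A. p \<eta> * F \<eta> * (1 / ?Z))"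
    by (rule infsetsum_infsum)
  also have "\<dots> = (\<Sum>\<^sub>\<infinity>\<eta>\<in>A. p \<eta> * F \<eta>) * (1 / ?Z)"
    using assms by (intro infsum_cmult_left)
  moreover have "(\<integral>\<eta>. F \<eta> \<partial>bd_measure T \<nu> A) = infsetsum (\<lambda>\<eta>. p \<eta> * F \<eta> * (1 / ?Z)) A"
    unfolding bd_measure_def point_measure_def infsetsum_def
    using Z weight_pos by (subst integral_density) (simp_all add: AE_count_space less_imp_le)
  ultimately show ?thesis by simp
qed

text \<open>The extension is a restriction of the adjoint, so it can be tested against the indicator of a
  point, where symmetry turns the adjoint relation into the pointwise formula. This makes the
  result independent of the choice in \<^const>\<open>friedrichs_op\<close>.\<close>

lemma bd_generator_eq:
  assumes ne: "A \<noteq> {}" and f: "f \<in> bounded_functions A" and dom: "f \<in> bd_domain T \<nu> A" and \<eta>: "\<eta> \<in> A"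
  shows "bd_generator T \<nu> A f \<eta> = L f \<eta>"
proof -
  let ?M = "bd_measure T \<nu> A" and ?Z = "partition_fn T \<nu> A"
  let ?h = "bd_generator T \<nu> A f"
  let ?e = "\<lambda>\<sigma>. of_bool (\<sigma> = \<eta>) :: real"
  have "friedrichs_graph ?M (bounded_functions A) L f ?h"
    using dom someI_ex[of "friedrichs_graph ?M (bounded_functions A) L f"]
    unfolding bd_domain_def friedrichs_domain_def bd_generator_def friedrichs_op_def mem_Collect_eq
    by blast
  moreover have e: "?e \<in> bounded_functions A" by (rule bounded_functionsI[of _ _ 1]) auto
  ultimately have inner: "L2_inner ?M f (L ?e) = L2_inner ?M ?h ?e"
    unfolding friedrichs_graph_def by blast
  have point: "((\<lambda>\<sigma>. p \<sigma> * (u \<sigma> * ?e \<sigma>)) has_sum p \<eta> * u \<eta>) A" for u :: "('a \<Rightarrow> nat) \<Rightarrow> real"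
    by (rule has_sum_finite_neutralI[of "{\<eta>}"]) (use \<eta> in auto)
  have "L2_inner ?M f (L ?e) = (\<Sum>\<^sub>\<infinity>\<sigma>\<in>A. p \<sigma> * (f \<sigma> * L ?e \<sigma>)) / ?Z"
    unfolding L2_inner_def by (rule integral_bd_measure[OF generator_summable[OF f e]])
  also have "(\<Sum>\<^sub>\<infinity>\<sigma>\<in>A. p \<sigma> * (f \<sigma> * L ?e \<sigma>)) = (\<Sum>\<^sub>\<infinity>\<sigma>\<in>A. p \<sigma> * (L f \<sigma> * ?e \<sigma>))"
    unfolding generator_symmetric[OF f e] by (simp add: mult.commute)
  also have "\<dots> = p \<eta> * L f \<eta>" by (rule infsumI[OF point])
  finally have "L2_inner ?M f (L ?e) = p \<eta> * L f \<eta> / ?Z" .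
  moreover have "L2_inner ?M ?h ?e = p \<eta> * ?h \<eta> / ?Z"
    unfolding L2_inner_def integral_bd_measure[OF has_sum_imp_summable[OF point]] infsumI[OF point] ..
  ultimately show ?thesis using inner weight_pos[of \<eta>] partition_fn_pos[OF ne] by simp
qed

lemma entropy_convexity:
  assumes ne: "A \<noteq> {}" and F: "f \<in> class_F T \<nu> A"
    and blocked: "\<And>x \<zeta>. x \<in> T \<Longrightarrow> \<zeta> \<in> edge_base x \<Longrightarrow> (\<Sum>y\<in>T-{x}. blocked_rate x y \<zeta>) \<le> 1"
    and k: "\<And>x \<zeta>. x \<in> T \<Longrightarrow> \<zeta> \<in> edge_base x \<Longrightarrow> k \<le> merging_rate x \<zeta>"
  shows "k * dirichlet_form T \<nu> A f (\<lambda>\<eta>. ln (f \<eta>))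
    \<le> (\<integral>\<eta>. bd_generator T \<nu> A (bd_generator T \<nu> A f) \<eta> * ln (f \<eta>) \<partial>bd_measure T \<nu> A)
      + (\<integral>\<eta>. (bd_generator T \<nu> A f \<eta>)\<^sup>2 / f \<eta> \<partial>bd_measure T \<nu> A)"
proof -
  let ?M = "bd_measure T \<nu> A" and ?Z = "partition_fn T \<nu> A"
  let ?g = "bd_generator T \<nu> A f"
  from F obtain M where pos: "\<And>\<eta>. \<eta> \<in> A \<Longrightarrow> 0 < f \<eta>" and M: "\<And>\<eta>. \<eta> \<in> A \<Longrightarrow> \<bar>ln (f \<eta>)\<bar> \<le> real M"
    and dom: "f \<in> bd_domain T \<nu> A" "?g \<in> bd_domain T \<nu> A" and g: "?g \<in> bounded_functions A"
    unfolding class_F_def bd_domain_sq_def by auto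
  have l: "(\<lambda>\<eta>. ln (f \<eta>)) \<in> bounded_functions A" using M by (rule bounded_functionsI)
  have bounds: "f \<eta> \<le> exp (real M)" "1 / f \<eta> \<le> exp (real M)" if "\<eta> \<in> A" for \<eta>
  proof -
    have "ln (f \<eta>) \<le> real M" "- real M \<le> ln (f \<eta>)" using M[OF that] by auto
    then have "exp (ln (f \<eta>)) \<le> exp (real M)" "exp (- real M) \<le> exp (ln (f \<eta>))" by simp_all
    then show "f \<eta> \<le> exp (real M)" "1 / f \<eta> \<le> exp (real M)"
      using pos[OF that] by (auto simp: exp_minus field_simps)
  qed
  have f: "f \<in> bounded_functions A"
    using bounds pos by (intro bounded_functionsI[of _ _ "exp (real M)"]) (auto simp: abs_of_pos)
  have r: "(\<lambda>\<eta>. 1 / f \<eta>) \<in> bounded_functions A"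
    using bounds pos by (intro bounded_functionsI[of _ _ "exp (real M)"]) (auto simp: abs_of_pos)
  have q: "(\<lambda>\<eta>. ?g \<eta> / f \<eta>) \<in> bounded_functions A"
    using bounded_functions_mult[OF g r] by simp
  note gen_f = bd_generator_eq[OF ne f dom(1)] and gen_g = bd_generator_eq[OF ne g dom(2)]
  have eval: "(\<integral>\<eta>. F \<eta> \<partial>?M) = (\<Sum>\<^sub>\<infinity>\<eta>\<in>A. p \<eta> * (u \<eta> * L v \<eta>)) / ?Z"
    if "u \<in> bounded_functions A" "v \<in> bounded_functions A" "\<And>\<eta>. \<eta> \<in> A \<Longrightarrow> F \<eta> = u \<eta> * L v \<eta>" for F u v
  proof -
    have "(\<lambda>\<eta>. p \<eta> * F \<eta>) summable_on A"
      using generator_summable[OF that(1,2)] that(3) by (simp cong: summable_on_cong)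
    from integral_bd_measure[OF this] that(3) show ?thesis by (simp cong: infsum_cong)
  qed
  have "dirichlet_form T \<nu> A f (\<lambda>\<eta>. ln (f \<eta>)) = - (\<Sum>\<^sub>\<infinity>\<eta>\<in>A. p \<eta> * (ln (f \<eta>) * L f \<eta>)) / ?Z"
    unfolding dirichlet_form_def by (subst eval[OF l f]) (simp_all add: gen_f)
  moreover have "(\<integral>\<eta>. bd_generator T \<nu> A ?g \<eta> * ln (f \<eta>) \<partial>?M)
      = (\<Sum>\<^sub>\<infinity>\<eta>\<in>A. p \<eta> * (ln (f \<eta>) * L ?g \<eta>)) / ?Z"
    by (rule eval[OF l g]) (simp add: gen_g)
  moreover have "(\<integral>\<eta>. (?g \<eta>)\<^sup>2 / f \<eta> \<partial>?M) = (\<Sum>\<^sub>\<infinity>\<eta>\<in>A. p \<eta> * (?g \<eta> / f \<eta> * L f \<eta>)) / ?Z"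
    by (rule eval[OF q f]) (simp add: gen_f power2_eq_square)
  moreover have "k * - (\<Sum>\<^sub>\<infinity>\<eta>\<in>A. p \<eta> * (ln (f \<eta>) * L f \<eta>)) / ?Z
    \<le> ((\<Sum>\<^sub>\<infinity>\<eta>\<in>A. p \<eta> * (ln (f \<eta>) * L ?g \<eta>)) + (\<Sum>\<^sub>\<infinity>\<eta>\<in>A. p \<eta> * (?g \<eta> / f \<eta> * L f \<eta>))) / ?Z"
    using entropy_convexity_infsum[OF pos f l q g gen_f blocked k] partition_fn_pos[OF ne]
    by (intro divide_right_mono) auto
  ultimately show ?thesis by (simp add: add_divide_distrib)
qed

end

theorem theorem3p4:
  fixes T :: "'a set" and \<nu> :: "'a \<Rightarrow> real" and A :: "('a \<Rightarrow> nat) set" and \<kappa> :: ereal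
  assumes "finite T"
    and "A \<noteq> {}"
    and "decreasing_set T A"
    and "\<forall>x\<in>T. \<nu> x > 0"
    and "eps0 T \<nu> A \<le> 1"
    and "\<kappa> = 1 - eps0 T \<nu> A + eps1 T \<nu> A"
  shows "\<forall>f\<in>class_F T \<nu> A.
     \<kappa> * ereal (dirichlet_form T \<nu> A f (\<lambda>\<eta>. ln (f \<eta>)))
     \<le> ereal ((\<integral>\<eta>. bd_generator T \<nu> A (bd_generator T \<nu> A f) \<eta> * ln (f \<eta>) \<partial>bd_measure T \<nu> A)
            + (\<integral>\<eta>. (bd_generator T \<nu> A f \<eta>)\<^sup>2 / f \<eta> \<partial>bd_measure T \<nu> A))"
proof
  interpret birth_death T \<nu> A using assms(1,3,4) by unfold_locales auto
  fix f assume F: "f \<in> class_F T \<nu> A"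
  let ?E = "dirichlet_form T \<nu> A f (\<lambda>\<eta>. ln (f \<eta>))"
  let ?R = "(\<integral>\<eta>. bd_generator T \<nu> A (bd_generator T \<nu> A f) \<eta> * ln (f \<eta>)
    \<partial>bd_measure T \<nu> A) + (\<integral>\<eta>. (bd_generator T \<nu> A f \<eta>)\<^sup>2 / f \<eta> \<partial>bd_measure T \<nu> A)"
  let ?I = "{(x, \<eta>). x \<in> T \<and> \<eta> \<in> A \<and> \<eta> x > 0}"
  have edge: "(x, add_delta \<zeta> x) \<in> ?I" if "x \<in> T" "\<zeta> \<in> edge_base x" for x \<zeta>
    using that by (auto simp: edge_base_def) (simp add: add_delta_def)
  have eps0_ge: "ereal (\<Sum>y\<in>T-{x}. blocked_rate x y \<zeta>) \<le> eps0 T \<nu> A"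
    if "x \<in> T" "\<zeta> \<in> edge_base x" for x \<zeta>
    using SUP_upper[OF edge[OF that], of "\<lambda>(x, \<eta>). ereal (\<Sum>y\<in>T - {x}. \<nu> y *
      of_bool (add_delta (sub_delta \<eta> x) y \<in> A) * of_bool (add_delta \<eta> y \<notin> A))"]
    unfolding eps0_def blocked_rate_def by simp
  have eps1_le: "eps1 T \<nu> A \<le> ereal (\<nu> x * of_bool (add_delta (add_delta \<zeta> x) x \<notin> A))"
    if "x \<in> T" "\<zeta> \<in> edge_base x" for x \<zeta>
    using INF_lower[OF edge[OF that], of "\<lambda>(x, \<eta>). ereal (\<nu> x * of_bool (add_delta \<eta> x \<notin> A))"]
    unfolding eps1_def by simp
  have blocked: "(\<Sum>y\<in>T-{x}. blocked_rate x y \<zeta>) \<le> 1" if "x \<in> T" "\<zeta> \<in> edge_base x" for x \<zeta>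
    using order_trans[OF eps0_ge[OF that] assms(5)] by simp
  note convexity = entropy_convexity[OF assms(2) F blocked]
  show "\<kappa> * ereal ?E \<le> ereal ?R"
  proof (cases "\<exists>x\<in>T. edge_base x \<noteq> {}")
    case False
    then have none: "\<zeta> \<notin> edge_base x" if "x \<in> T" for x \<zeta> using that by blast
    \<comment> \<open>There are no edges and \<open>\<kappa>\<close> is infinite. Since every real constant is admissible, the Dirichlet
      form must vanish.\<close>
    have all: "k * ?E \<le> ?R" for k using convexity none by blast
    have "?E = 0"
    proof (rule ccontr)
      assume "?E \<noteq> 0"
      then show False using all[of "(?R + 1) / ?E"] by simp
    qed
    with all[of 0] show ?thesis by (simp add: zero_ereal_def[symmetric])
  next
    case True
    then obtain x0 \<zeta>0 where e0: "x0 \<in> T" "\<zeta>0 \<in> edge_base x0" by blast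
    have "0 \<le> (\<Sum>y\<in>T-{x0}. blocked_rate x0 y \<zeta>0)"
      unfolding blocked_rate_def by (intro sum_nonneg) (auto intro: rate_pos[THEN less_imp_le])
    then have "0 \<le> eps0 T \<nu> A" using eps0_ge[OF e0] by (meson ereal_less_eq(5) order_trans)
    with assms(5) obtain a where a: "eps0 T \<nu> A = ereal a"
      by (cases "eps0 T \<nu> A") auto
    have "0 \<le> eps1 T \<nu> A"
      unfolding eps1_def by (intro INF_greatest) (auto intro: rate_pos[THEN less_imp_le])
    with eps1_le[OF e0] obtain b where b: "eps1 T \<nu> A = ereal b"
      by (cases "eps1 T \<nu> A") auto
    have "1 - a + b \<le> merging_rate x \<zeta>" if "x \<in> T" "\<zeta> \<in> edge_base x" for x \<zeta>
      using eps0_ge[OF that] eps1_le[OF that] unfolding a b merging_rate_def by simp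
    from convexity[OF _ _ this] have "(1 - a + b) * ?E \<le> ?R" by blast
    moreover have "\<kappa> = ereal (1 - a + b)" by (simp add: assms(6) a b one_ereal_def)
    ultimately show ?thesis by simp
  qed
qed

end
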